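(* If a group $G$ is not torsion-free, then it does not admit any midpointed convexoid.
   Context: A convexoid on $G$ is a family $\mathcal{C}$ of finite subsets of $G$ such that $\emptyset \in \mathcal{C}$, every finite subset of $G$ is contained in some element of $\mathcal{C}$, and whenever $C, D \in \mathcal{C}$ with $C \subsetneq D$ there is $a \in D \setminus C$ with $C \cup \{a\} \in \mathcal{C}$. For finite $B \subset G$ put $\overline{B} = \bigcap\{C \in \mathcal{C} : B \subset C\}$. The convexoid is midpointed if $g \in \overline{\{gh, gh^{-1}\}}$ for all $g,h \in G$. (No translation-invariance is assumed.) Torsion-free means all nontrivial elements have infinite order. *)

theory Defs
  imports "HOL-Algebra.Multiplicative_Group"
begin

definition convexoid :: "'a set \<Rightarrow> 'a set set \<Rightarrow> bool" where
  "convexoid X \<C> \<longleftrightarrow>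
     (\<forall>C\<in>\<C>. finite C \<and> C \<subseteq> X) \<and>
     {} \<in> \<C> \<and>
     (\<forall>F. finite F \<and> F \<subseteq> X \<longrightarrow> (\<exists>C\<in>\<C>. F \<subseteq> C)) \<and>
     (\<forall>C\<in>\<C>. \<forall>D\<in>\<C>. C \<subset> D \<longrightarrow> (\<exists>a\<in>D - C. C \<union> {a} \<in> \<C>))"

(* The family below is nonempty for finite B contained in X whenever "convexoid X \<C>",
   so the convention that an empty intersection is UNIV plays no role. *)
definition convexoid_closure :: "'a set set \<Rightarrow> 'a set \<Rightarrow> 'a set" where
  "convexoid_closure \<C> B = \<Inter>{C \<in> \<C>. B \<subseteq> C}"

definition midpointed :: "('a, 'b) monoid_scheme \<Rightarrow> 'a set set \<Rightarrow> bool" where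
  "midpointed G \<C> \<longleftrightarrow>
     (\<forall>g\<in>carrier G. \<forall>h\<in>carrier G.
        g \<in> convexoid_closure \<C> {g \<otimes>\<^bsub>G\<^esub> h, g \<otimes>\<^bsub>G\<^esub> inv\<^bsub>G\<^esub> h})"

(* "group.ord G x = 0" is the library's encoding of infinite order, see ord_eq_0. *)
definition torsion_free :: "('a, 'b) monoid_scheme \<Rightarrow> bool" where
  "torsion_free G \<longleftrightarrow> (\<forall>x\<in>carrier G. x \<noteq> \<one>\<^bsub>G\<^esub> \<longrightarrow> group.ord G x = 0)"

end

theory Submission
  imports Defs
begin

text \<open>
  Let \<open>x \<noteq> \<one>\<close> have finite order, so that the powers of \<open>x\<close> form a finite set \<open>H\<close>.
  In a convexoid one can grow \<open>\<emptyset>\<close>, one element at a time and without leaving the family, up to a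
  member containing \<open>H\<close>. Just before \<open>H\<close> is exhausted, the member \<open>C\<close> reached omits exactly one
  element \<open>a\<close> of \<open>H\<close> (lemma \<open>convexoid_misses_exactly_one\<close>). But \<open>a x\<close> and
  \<open>a x\<inverse>\<close> are elements of \<open>H\<close> different from \<open>a\<close>, hence they lie in \<open>C\<close>, and the midpoint
  property forces \<open>a \<in> C\<close>, a contradiction.
\<close>

text \<open>
  This is the last moment at which a one-element-at-a-time chain from \<open>{}\<close> to a superset of
  \<open>F\<close> fails to contain \<open>F\<close>; instead of building the chain, one takes a member of maximal size below
  that superset that does not contain \<open>F\<close>.
\<close>
lemma convexoid_misses_exactly_one:
  assumes conv: "convexoid X \<C>" and F: "finite F" "F \<subseteq> X" "F \<noteq> {}"
  obtains C a where "C \<in> \<C>" "F - C = {a}"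
proof -
  have fin: "\<forall>C\<in>\<C>. finite C \<and> C \<subseteq> X" and "{} \<in> \<C>"
    and cover: "\<forall>F. finite F \<and> F \<subseteq> X \<longrightarrow> (\<exists>C\<in>\<C>. F \<subseteq> C)"
    and grow: "\<forall>C\<in>\<C>. \<forall>D\<in>\<C>. C \<subset> D \<longrightarrow> (\<exists>a\<in>D - C. C \<union> {a} \<in> \<C>)"
    using conv unfolding convexoid_def by - (elim conjE, assumption)+
  from cover F(1,2) obtain D where D: "D \<in> \<C>" "F \<subseteq> D"
    by meson
  with fin have finD: "finite D"
    by simp
  define M where "M = {C \<in> \<C>. C \<subseteq> D \<and> \<not> F \<subseteq> C}"
  have "finite M"
    by (rule finite_subset[of _ "Pow D"]) (use finD in \<open>auto simp: M_def\<close>)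
  moreover have "{} \<in> M"
    using F(3) \<open>{} \<in> \<C>\<close> by (simp add: M_def)
  ultimately obtain C where C: "C \<in> M" and max: "\<And>B. B \<in> M \<Longrightarrow> C \<subseteq> B \<Longrightarrow> C = B"
    using finite_has_maximal[of M] by blast
  have "C \<in> \<C>" "C \<subset> D" "\<not> F \<subseteq> C"
    using C D unfolding M_def by auto
  with grow D(1) obtain a where a: "a \<in> D - C" "C \<union> {a} \<in> \<C>"
    by meson
  have "C \<union> {a} \<notin> M"
    using max[of "C \<union> {a}"] a(1) by auto
  hence "F \<subseteq> C \<union> {a}"
    using a \<open>C \<subset> D\<close> by (simp add: M_def psubset_eq)
  hence "F - C = {a}"
    using \<open>\<not> F \<subseteq> C\<close> by blast
  with \<open>C \<in> \<C>\<close> show thesis by (rule that)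
qed

theorem proposition50:
  fixes G :: "('a, 'b) monoid_scheme"
  assumes "group G"
    and "\<not> torsion_free G"
  shows "\<not> (\<exists>\<C>. convexoid (carrier G) \<C> \<and> midpointed G \<C>)"
proof
  interpret group G by fact
  assume "\<exists>\<C>. convexoid (carrier G) \<C> \<and> midpointed G \<C>"
  then obtain \<C> where conv: "convexoid (carrier G) \<C>" and mid: "midpointed G \<C>"
    by blast
  obtain x where x: "x \<in> carrier G" "x \<noteq> \<one>\<^bsub>G\<^esub>" "ord x \<noteq> 0"
    using assms(2) unfolding torsion_free_def by blast
  define H where "H = generate G {x}"
  have sub: "subgroup H G" and xH: "x \<in> H"
    using x generate_is_subgroup[of "{x}"] by (auto simp: H_def intro: generate.incl)
  have "finite H"
    using x generate_pow_card[of x] card_ge_0_finite[of H] by (simp add: H_def)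
  moreover have "H \<subseteq> carrier G" "H \<noteq> {}"
    using subgroup.subset[OF sub] xH by auto
  ultimately obtain C a where C: "C \<in> \<C>" and a: "H - C = {a}"
    by (rule convexoid_misses_exactly_one[OF conv])
  have aH: "a \<in> H" and aG: "a \<in> carrier G" and "a \<notin> C"
    using a subgroup.subset[OF sub] by auto
  have "a \<otimes>\<^bsub>G\<^esub> x \<in> H" "a \<otimes>\<^bsub>G\<^esub> inv\<^bsub>G\<^esub> x \<in> H"
    using sub aH xH by (simp_all add: subgroup.m_closed subgroup.m_inv_closed)
  moreover have "a \<otimes>\<^bsub>G\<^esub> x \<noteq> a" "a \<otimes>\<^bsub>G\<^esub> inv\<^bsub>G\<^esub> x \<noteq> a"
    using x aG by (auto simp: l_cancel_one inv_eq_1_iff)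
  ultimately have "{a \<otimes>\<^bsub>G\<^esub> x, a \<otimes>\<^bsub>G\<^esub> inv\<^bsub>G\<^esub> x} \<subseteq> C"
    using a by blast
  moreover have "a \<in> convexoid_closure \<C> {a \<otimes>\<^bsub>G\<^esub> x, a \<otimes>\<^bsub>G\<^esub> inv\<^bsub>G\<^esub> x}"
    using mid aG x unfolding midpointed_def by blast
  ultimately have "a \<in> C"
    using C unfolding convexoid_closure_def by blast
  with \<open>a \<notin> C\<close> show False ..
qed

end
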